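(* Let $G$ be a group, let $\Gamma<G$ be a subgroup, let $K<\Gamma$ be a normal subgroup of $\Gamma$, and let $Q=\Gamma/K$. If $g\in \mathrm{Comm}_G(K)\cap \mathrm{Comm}_G(\Gamma)$, then $K^g=g^{-1}Kg$ preserves $Q$-lines with holes; that is, every element of $K^g$ preserves $Q$-lines with holes.
   Context: For an element $h$ and an element or subgroup $x$ of $G$, $x^h=h^{-1}xh$. The commensurator $\mathrm{Comm}_G(H)$ of a subgroup $H<G$ is the subgroup of all $g\in G$ such that $H\cap H^g$ has finite index in both $H$ and $H^g$. An element $h\in \mathrm{Comm}_G(\Gamma)$ preserves $Q$-lines with holes (where $Q=\Gamma/K$) if for every $\gamma\in\Gamma$ there exists an integer $N>0$ such that $\gamma^n\equiv(\gamma^n)^h \pmod K$ for all $n\in N\mathbb{Z}$, i.e. $(\gamma^n)^h\in\Gamma$ and $(\gamma^n)^h\gamma^{-n}\in K$ for all $n\in N\mathbb{Z}$. (Elements of $K^g$ lie in $\mathrm{Comm}_G(\Gamma)$ since $K^g<\Gamma^g$ and $\Gamma^g$ is commensurable with $\Gamma$.) *)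

theory Defs
  imports "HOL-Algebra.Algebra"
begin

text \<open>Conjugation is on the right: \<open>x\<^sup>h = h\<^sup>-\<^sup>1 x h\<close>, for elements and, pointwise, for subsets.\<close>

definition conj_elt :: "('a, 'b) monoid_scheme \<Rightarrow> 'a \<Rightarrow> 'a \<Rightarrow> 'a"
  where "conj_elt G h x = inv\<^bsub>G\<^esub> h \<otimes>\<^bsub>G\<^esub> x \<otimes>\<^bsub>G\<^esub> h"

definition conj_set :: "('a, 'b) monoid_scheme \<Rightarrow> 'a \<Rightarrow> 'a set \<Rightarrow> 'a set"
  where "conj_set G h S = conj_elt G h ` S"

definition finite_index :: "('a, 'b) monoid_scheme \<Rightarrow> 'a set \<Rightarrow> 'a set \<Rightarrow> bool"
  where "finite_index G L H \<longleftrightarrow>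
    subgroup L (G\<lparr>carrier := H\<rparr>) \<and> finite (rcosets\<^bsub>G\<lparr>carrier := H\<rparr>\<^esub> L)"

definition commensurator :: "('a, 'b) monoid_scheme \<Rightarrow> 'a set \<Rightarrow> 'a set"
  where "commensurator G H = {g \<in> carrier G.
    finite_index G (H \<inter> conj_set G g H) H \<and>
    finite_index G (H \<inter> conj_set G g H) (conj_set G g H)}"

text \<open>The quotient \<open>Q = \<Gamma> / K\<close> enters only through the pair \<open>\<Gamma>\<close>, \<open>K\<close>.
  The congruence modulo \<open>K\<close> includes the requirement that the conjugated power lies in \<open>\<Gamma>\<close>,
  and the exponent ranges over all multiples of \<open>N\<close>, negative ones included.\<close>

definition preserves_lines_with_holes ::
    "('a, 'b) monoid_scheme \<Rightarrow> 'a set \<Rightarrow> 'a set \<Rightarrow> 'a \<Rightarrow> bool"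
  where "preserves_lines_with_holes G \<Gamma> K h \<longleftrightarrow>
    h \<in> commensurator G \<Gamma> \<and>
    (\<forall>\<gamma>\<in>\<Gamma>. \<exists>N::int. N > 0 \<and> (\<forall>n::int. N dvd n \<longrightarrow>
      conj_elt G h (\<gamma> [^]\<^bsub>G\<^esub> n) \<in> \<Gamma> \<and>
      conj_elt G h (\<gamma> [^]\<^bsub>G\<^esub> n) \<otimes>\<^bsub>G\<^esub> \<gamma> [^]\<^bsub>G\<^esub> (- n) \<in> K))"

end

theory Submission
  imports Defs
begin

text \<open>
  Let \<open>h \<in> K\<^sup>g\<close>. The elements \<open>d \<in> \<Gamma>\<close> with \<open>d\<^sup>h \<equiv> d\<close> modulo \<open>K\<close> form a subgroup \<open>S\<close> of \<open>\<Gamma>\<close>, and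
  \<open>h\<close> preserves lines with holes if every \<open>\<gamma> \<in> \<Gamma>\<close> has a positive power in \<open>S\<close>. It therefore suffices
  that \<open>S\<close> has finite index in \<open>\<Gamma>\<close>. Since \<open>\<Gamma> \<inter> \<Gamma>\<^sup>g\<close> has finite index in \<open>\<Gamma>\<close>, it is even enough to
  find \<open>S\<close> of finite index relative to \<open>\<Gamma> \<inter> \<Gamma>\<^sup>g\<close>. An element \<open>d\<close> of this intersection normalizes
  \<open>K\<close>, because \<open>d \<in> \<Gamma>\<close>, and \<open>K\<^sup>g\<close>, because \<open>d \<in> \<Gamma>\<^sup>g\<close>. It thus permutes the cosets of
  \<open>K \<inter> K\<^sup>g\<close> in \<open>K\<^sup>g\<close>, of which there are finitely many, and \<open>S\<close> contains the stabilizer of the coset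
  of \<open>h\<close>. In terms of elements, the commutator \<open>d\<^sup>-\<^sup>1 h\<^sup>-\<^sup>1 d h\<close> lies in \<open>K\<^sup>g\<close>, and the coset of \<open>d\<close>
  modulo \<open>S\<close> is determined by the coset of this commutator modulo \<open>K\<close>.

  That \<open>h\<close> commensurates \<open>\<Gamma>\<close> is seen by comparison with \<open>\<Gamma>\<^sup>g\<close>: this group contains \<open>h\<close>, so
  conjugation by \<open>h\<close> fixes it and carries its commensurability with \<open>\<Gamma>\<close> to
  commensurability with \<open>\<Gamma>\<^sup>h\<close>.

  Both parts use the relation that \<open>A\<close> is covered by finitely many right cosets of \<open>B\<close>. It amounts to
  finite index of \<open>A \<inter> B\<close> in \<open>A\<close>, but its transitivity and its invariance under
  conjugation are immediate.
\<close>

section \<open>Covering by finitely many cosets\<close>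

text \<open>The condition \<open>a f\<^sup>-\<^sup>1 \<in> B\<close> says that \<open>a\<close> lies in the right coset \<open>B f\<close>. The
  representatives are not required to lie in \<open>A\<close>, which is what makes transitivity easy.\<close>

definition virtually_contained :: "('a, 'b) monoid_scheme \<Rightarrow> 'a set \<Rightarrow> 'a set \<Rightarrow> bool"
  where "virtually_contained G A B \<longleftrightarrow>
    (\<exists>F. finite F \<and> F \<subseteq> carrier G \<and> (\<forall>a\<in>A. \<exists>f\<in>F. a \<otimes>\<^bsub>G\<^esub> inv\<^bsub>G\<^esub> f \<in> B))"

text \<open>Modulo \<open>K\<close> this is the equalizer of \<open>d \<mapsto> d\<^sup>h\<close> and the identity, which is why it is a
  subgroup when \<open>K\<close> is normal in \<open>H\<close>.\<close>

definition fixed_modulo :: "('a, 'b) monoid_scheme \<Rightarrow> 'a set \<Rightarrow> 'a set \<Rightarrow> 'a \<Rightarrow> 'a set"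
  where "fixed_modulo G H K h =
    {d \<in> H. conj_elt G h d \<otimes>\<^bsub>G\<^esub> inv\<^bsub>G\<^esub> d \<in> K}"

context group
begin

lemma inv_mult_cancel_left:
  assumes "x \<in> carrier G" "y \<in> carrier G"
  shows "inv x \<otimes> (x \<otimes> y) = y" and "x \<otimes> (inv x \<otimes> y) = y"
  using assms by (simp_all add: m_assoc[symmetric])

lemmas group_word_simps = m_assoc inv_mult_group inv_mult_cancel_left

lemma virtually_contained_trans:
  assumes AB: "virtually_contained G A B" and BC: "virtually_contained G B C"
    and A: "A \<subseteq> carrier G"
  shows "virtually_contained G A C"
proof -
  obtain F where F: "finite F" "F \<subseteq> carrier G" "\<forall>a\<in>A. \<exists>f\<in>F. a \<otimes> inv f \<in> B"
    using AB unfolding virtually_contained_def by blast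
  obtain E where E: "finite E" "E \<subseteq> carrier G" "\<forall>b\<in>B. \<exists>e\<in>E. b \<otimes> inv e \<in> C"
    using BC unfolding virtually_contained_def by blast
  let ?D = "(\<lambda>(e, f). e \<otimes> f) ` (E \<times> F)"
  have "\<exists>d\<in>?D. a \<otimes> inv d \<in> C" if a: "a \<in> A" for a
  proof -
    obtain f where f: "f \<in> F" "a \<otimes> inv f \<in> B" using F a by blast
    obtain e where e: "e \<in> E" "(a \<otimes> inv f) \<otimes> inv e \<in> C" using E f by blast
    have "a \<in> carrier G" "e \<in> carrier G" "f \<in> carrier G" using a e f A E F by auto
    then have "a \<otimes> inv (e \<otimes> f) \<in> C" using e by (simp add: group_word_simps)
    then show ?thesis using e f by (intro bexI[of _ "e \<otimes> f"]) auto
  qed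
  moreover have "finite ?D" "?D \<subseteq> carrier G" using E F by auto
  ultimately show ?thesis unfolding virtually_contained_def by blast
qed

text \<open>For a map with finite image, one preimage of each value represents the cosets.\<close>

lemma virtually_contained_if_finite_image:
  assumes A: "A \<subseteq> carrier G" and fin: "finite (\<phi> ` A)"
    and fibre: "\<And>i j. i \<in> A \<Longrightarrow> j \<in> A \<Longrightarrow> \<phi> i = \<phi> j \<Longrightarrow> i \<otimes> inv j \<in> S"
  shows "virtually_contained G A S"
proof -
  let ?F = "inv_into A \<phi> ` \<phi> ` A"
  have "a \<otimes> inv (inv_into A \<phi> (\<phi> a)) \<in> S" if "a \<in> A" for a
    using that by (intro fibre) (auto simp: inv_into_into f_inv_into_f)
  moreover have "?F \<subseteq> carrier G" using A by (auto simp: inv_into_into subset_iff)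
  ultimately show ?thesis using fin unfolding virtually_contained_def
    by (intro exI[of _ ?F]) auto
qed

text \<open>Elements of one coset \<open>B f\<close> differ by an element of \<open>B\<close>; hence a map into \<open>B F\<close> induces one
  into the finite set \<open>F\<close>.\<close>

lemma virtually_contained_vimage:
  assumes AB: "virtually_contained G A B" and B: "subgroup B G" and A: "A \<subseteq> carrier G"
    and C: "C \<subseteq> carrier G" and \<psi>: "\<psi> ` C \<subseteq> A"
    and fibre: "\<And>i j. i \<in> C \<Longrightarrow> j \<in> C \<Longrightarrow> \<psi> i \<otimes> inv (\<psi> j) \<in> B \<Longrightarrow> i \<otimes> inv j \<in> S"
  shows "virtually_contained G C S"
proof -
  obtain F where F: "finite F" "F \<subseteq> carrier G" "\<forall>a\<in>A. \<exists>f\<in>F. a \<otimes> inv f \<in> B"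
    using AB unfolding virtually_contained_def by blast
  then obtain \<rho> where \<rho>: "\<And>a. a \<in> A \<Longrightarrow> \<rho> a \<in> F \<and> a \<otimes> inv (\<rho> a) \<in> B" by metis
  show ?thesis
  proof (rule virtually_contained_if_finite_image[OF C, of "\<lambda>c. \<rho> (\<psi> c)"])
    have "(\<lambda>c. \<rho> (\<psi> c)) ` C \<subseteq> F" using \<rho> \<psi> by auto
    then show "finite ((\<lambda>c. \<rho> (\<psi> c)) ` C)" using F finite_subset by blast
  next
    fix i j assume ij: "i \<in> C" "j \<in> C" "\<rho> (\<psi> i) = \<rho> (\<psi> j)"
    let ?f = "\<rho> (\<psi> j)"
    have mem: "\<psi> i \<in> A" "\<psi> j \<in> A" using ij \<psi> by auto
    have carr: "\<psi> i \<in> carrier G" "\<psi> j \<in> carrier G" "?f \<in> carrier G"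
      using mem A \<rho> F by auto
    have "(\<psi> i \<otimes> inv ?f) \<otimes> inv (\<psi> j \<otimes> inv ?f) \<in> B"
      using \<rho>[OF mem(1)] \<rho>[OF mem(2)] ij B
      by (auto intro: subgroup.m_closed subgroup.m_inv_closed)
    then have "\<psi> i \<otimes> inv (\<psi> j) \<in> B" using carr by (simp add: group_word_simps)
    then show "i \<otimes> inv j \<in> S" using fibre ij by blast
  qed
qed

text \<open>By the pigeonhole principle two powers of \<open>a\<close> lie in one coset of \<open>B\<close>.\<close>

lemma int_pow_mem_if_virtually_contained:
  assumes AB: "virtually_contained G A B" and A: "subgroup A G" and B: "subgroup B G"
    and a: "a \<in> A"
  shows "\<exists>N::int. N > 0 \<and> (\<forall>n. N dvd n \<longrightarrow> a [^] n \<in> B)"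
proof -
  have acarr: "a \<in> carrier G" using A a by (rule subgroup.mem_carrier)
  obtain F where F: "finite F" "F \<subseteq> carrier G" "\<forall>a\<in>A. \<exists>f\<in>F. a \<otimes> inv f \<in> B"
    using AB unfolding virtually_contained_def by blast
  then obtain \<rho> where \<rho>: "\<And>a. a \<in> A \<Longrightarrow> \<rho> a \<in> F \<and> a \<otimes> inv (\<rho> a) \<in> B" by metis
  have pow: "a [^] (n::nat) \<in> A" for n
    using A a by (induction n) (auto intro: subgroup.m_closed subgroup.one_closed)
  have "range (\<lambda>n::nat. \<rho> (a [^] n)) \<subseteq> F" using \<rho> pow by auto
  then have "finite (range (\<lambda>n::nat. \<rho> (a [^] n)))" using F finite_subset by blast
  then have "\<not> inj (\<lambda>n::nat. \<rho> (a [^] n))" using finite_imageD infinite_UNIV_nat by blast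
  then obtain i j :: nat where ij: "i < j" "\<rho> (a [^] i) = \<rho> (a [^] j)"
    unfolding inj_on_def by (metis nat_neq_iff)
  let ?f = "\<rho> (a [^] j)"
  have fcarr: "?f \<in> carrier G" using \<rho> pow F by blast
  have "(a [^] j \<otimes> inv ?f) \<otimes> inv (a [^] i \<otimes> inv ?f) \<in> B"
    using \<rho>[OF pow[of i]] \<rho>[OF pow[of j]] ij B
    by (auto intro: subgroup.m_closed subgroup.m_inv_closed)
  then have "a [^] j \<otimes> inv (a [^] i) \<in> B"
    using fcarr acarr by (simp add: group_word_simps)
  then have "a [^] (int j - int i) \<in> B"
    using acarr by (simp add: int_pow_diff int_pow_int)
  moreover obtain p :: int where "p = int j - int i" by blast
  ultimately have base: "a [^] p \<in> B" and p: "p > 0" using ij by auto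
  have "a [^] n \<in> B" if n: "p dvd n" for n
  proof -
    obtain k where "n = p * k" using n by (rule dvdE)
    then have "a [^] n = (a [^] p) [^] k"
      using int_pow_pow[OF acarr, of p k] by metis
    also have "\<dots> \<in> B" using B base by (rule subgroup_int_pow_closed)
    finally show ?thesis .
  qed
  then show ?thesis using p by blast
qed

section \<open>Comparison with finite index\<close>

lemma virtually_contained_if_finite_index:
  assumes "finite_index G L H" and H: "subgroup H G"
  shows "virtually_contained G H L"
proof -
  have L: "subgroup L (G\<lparr>carrier := H\<rparr>)" and fin: "finite (rcosets\<^bsub>G\<lparr>carrier := H\<rparr>\<^esub> L)"
    using assms unfolding finite_index_def by auto
  have Lsub: "subgroup L G" using L H by (simp add: incl_subgroup)
  have Hcarr: "H \<subseteq> carrier G" using H by (rule subgroup.subset)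
  show ?thesis
  proof (rule virtually_contained_if_finite_image[OF Hcarr, of "\<lambda>a. L #> a"])
    show "finite ((\<lambda>a. L #> a) ` H)"
      using fin by (simp add: RCOSETS_def r_coset_def image_UN UNION_singleton_eq_range)
  next
    fix i j assume ij: "i \<in> H" "j \<in> H" "L #> i = L #> j"
    have carr: "i \<in> carrier G" "j \<in> carrier G" using ij Hcarr by auto
    have "i \<in> L #> j" using ij carr rcos_self[OF _ Lsub] by metis
    then obtain l where l: "l \<in> L" "i = l \<otimes> j" unfolding r_coset_def by blast
    then have "i \<otimes> inv j = l"
      using carr subgroup.mem_carrier[OF Lsub] by (simp add: group_word_simps)
    then show "i \<otimes> inv j \<in> L" using l by simp
  qed
qed

lemma finite_index_if_virtually_contained:
  assumes AB: "virtually_contained G A B" and A: "subgroup A G" and B: "subgroup B G"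
  shows "finite_index G (A \<inter> B) A"
proof -
  let ?L = "A \<inter> B"
  have L: "subgroup ?L G" using A B by (rule subgroups_Inter_pair)
  have Acarr: "A \<subseteq> carrier G" using A by (rule subgroup.subset)
  have "virtually_contained G A ?L"
    by (rule virtually_contained_vimage[OF AB B Acarr Acarr, of id])
      (use A in \<open>auto intro: subgroup.m_closed subgroup.m_inv_closed\<close>)
  then obtain F where F: "finite F" "F \<subseteq> carrier G" "\<forall>a\<in>A. \<exists>f\<in>F. a \<otimes> inv f \<in> ?L"
    unfolding virtually_contained_def by blast
  have "(\<lambda>a. ?L #> a) ` A \<subseteq> (\<lambda>a. ?L #> a) ` F"
  proof
    fix C assume "C \<in> (\<lambda>a. ?L #> a) ` A"
    then obtain a where a: "a \<in> A" "C = ?L #> a" by blast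
    then obtain f where f: "f \<in> F" "a \<otimes> inv f \<in> ?L" using F by blast
    have carr: "a \<in> carrier G" "f \<in> carrier G" using a f Acarr F by auto
    have "a = (a \<otimes> inv f) \<otimes> f" using carr by (simp add: m_assoc)
    then have "a \<in> ?L #> f" using f unfolding r_coset_def by blast
    then have "?L #> a = ?L #> f" using repr_independence[OF _ _ L] carr by metis
    then show "C \<in> (\<lambda>a. ?L #> a) ` F" using a f by auto
  qed
  then have "finite ((\<lambda>a. ?L #> a) ` A)" using F finite_subset by blast
  moreover have "rcosets\<^bsub>G\<lparr>carrier := A\<rparr>\<^esub> ?L = (\<lambda>a. ?L #> a) ` A"
    by (auto simp: RCOSETS_def r_coset_def)
  moreover have "subgroup ?L (G\<lparr>carrier := A\<rparr>)" using subgroup_incl[OF L A] by simp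
  ultimately show ?thesis unfolding finite_index_def by simp
qed

section \<open>Conjugation\<close>

lemma conj_elt_closed [simp]:
  "h \<in> carrier G \<Longrightarrow> x \<in> carrier G \<Longrightarrow> conj_elt G h x \<in> carrier G"
  by (simp add: conj_elt_def)

lemma conj_elt_mult:
  "h \<in> carrier G \<Longrightarrow> x \<in> carrier G \<Longrightarrow> y \<in> carrier G \<Longrightarrow>
    conj_elt G h (x \<otimes> y) = conj_elt G h x \<otimes> conj_elt G h y"
  by (simp add: conj_elt_def group_word_simps)

lemma conj_elt_inv:
  "h \<in> carrier G \<Longrightarrow> x \<in> carrier G \<Longrightarrow> conj_elt G h (inv x) = inv (conj_elt G h x)"
  by (simp add: conj_elt_def group_word_simps)

lemma conj_elt_inv_cancel:
  "h \<in> carrier G \<Longrightarrow> x \<in> carrier G \<Longrightarrow> conj_elt G h (conj_elt G (inv h) x) = x"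
  by (simp add: conj_elt_def group_word_simps)

lemma subgroup_conj_set:
  assumes h: "h \<in> carrier G" and H: "subgroup H G"
  shows "subgroup (conj_set G h H) G"
proof -
  have "group_hom G G (conj_elt G h)"
    using h by unfold_locales (auto simp: hom_def conj_elt_mult)
  then show ?thesis unfolding conj_set_def using H by (rule group_hom.subgroup_img_is_subgroup)
qed

lemma conj_set_eq_self:
  assumes H: "subgroup H G" and h: "h \<in> H"
  shows "conj_set G h H = H"
proof
  show "conj_set G h H \<subseteq> H" unfolding conj_set_def conj_elt_def
    using H h by (auto intro: subgroup.m_closed subgroup.m_inv_closed)
next
  show "H \<subseteq> conj_set G h H"
  proof
    fix x assume x: "x \<in> H"
    have carr: "h \<in> carrier G" "x \<in> carrier G"
      using H h x by (auto intro: subgroup.mem_carrier)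
    have "conj_elt G (inv h) x \<in> H"
      using H h x carr unfolding conj_elt_def
      by (auto intro!: subgroup.m_closed subgroup.m_inv_closed)
    then show "x \<in> conj_set G h H"
      unfolding conj_set_def using conj_elt_inv_cancel[OF carr] by (metis image_eqI)
  qed
qed

lemma virtually_contained_conj_set:
  assumes AB: "virtually_contained G A B" and A: "A \<subseteq> carrier G" and h: "h \<in> carrier G"
  shows "virtually_contained G (conj_set G h A) (conj_set G h B)"
proof -
  obtain F where F: "finite F" "F \<subseteq> carrier G" "\<forall>a\<in>A. \<exists>f\<in>F. a \<otimes> inv f \<in> B"
    using AB unfolding virtually_contained_def by blast
  have "\<exists>f\<in>conj_elt G h ` F. a \<otimes> inv f \<in> conj_set G h B" if a: "a \<in> conj_set G h A" for a
  proof -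
    obtain b where b: "b \<in> A" "a = conj_elt G h b" using a unfolding conj_set_def by blast
    then obtain f where f: "f \<in> F" "b \<otimes> inv f \<in> B" using F by blast
    have "b \<in> carrier G" "f \<in> carrier G" using b f A F by auto
    then have "a \<otimes> inv (conj_elt G h f) = conj_elt G h (b \<otimes> inv f)"
      using b h by (simp add: conj_elt_mult conj_elt_inv)
    then show ?thesis using f unfolding conj_set_def by auto
  qed
  moreover have "conj_elt G h ` F \<subseteq> carrier G" using F h by auto
  ultimately show ?thesis unfolding virtually_contained_def
    using F(1) by (intro exI[of _ "conj_elt G h ` F"]) auto
qed

section \<open>The commensurator\<close>

lemma commensurator_iff:
  assumes H: "subgroup H G"
  shows "g \<in> commensurator G H \<longleftrightarrow> g \<in> carrier G \<and>
    virtually_contained G H (conj_set G g H) \<and> virtually_contained G (conj_set G g H) H"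
proof (cases "g \<in> carrier G")
  case True
  have Hg: "subgroup (conj_set G g H) G" using True H by (rule subgroup_conj_set)
  have "finite_index G (A \<inter> B) A \<longleftrightarrow> virtually_contained G A B"
    if A: "subgroup A G" and B: "subgroup B G" for A B
  proof
    assume "finite_index G (A \<inter> B) A"
    then have "virtually_contained G A (A \<inter> B)"
      using A by (rule virtually_contained_if_finite_index)
    then show "virtually_contained G A B" unfolding virtually_contained_def by (meson IntD2)
  next
    assume "virtually_contained G A B"
    then show "finite_index G (A \<inter> B) A" using A B by (rule finite_index_if_virtually_contained)
  qed
  from this[OF H Hg] this[OF Hg H] show ?thesis
    using True unfolding commensurator_def by (simp add: Int_commute)
qed (simp add: commensurator_def)

text \<open>Conjugation by \<open>h\<close> fixes \<open>H\<^sup>g\<close>, so \<open>H\<^sup>h\<close> is commensurable with \<open>H\<^sup>g\<close> because \<open>H\<close> is.\<close>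

lemma conj_set_subset_commensurator:
  assumes H: "subgroup H G" and g: "g \<in> commensurator G H"
  shows "conj_set G g H \<subseteq> commensurator G H"
proof
  fix h assume h: "h \<in> conj_set G g H"
  have gcarr: "g \<in> carrier G" and HHg: "virtually_contained G H (conj_set G g H)"
    and HgH: "virtually_contained G (conj_set G g H) H"
    using g unfolding commensurator_iff[OF H] by auto
  have Hg: "subgroup (conj_set G g H) G" using gcarr H by (rule subgroup_conj_set)
  have hcarr: "h \<in> carrier G" using Hg h by (rule subgroup.mem_carrier)
  have sub: "H \<subseteq> carrier G" "conj_set G g H \<subseteq> carrier G" "conj_set G h H \<subseteq> carrier G"
    using H Hg subgroup_conj_set[OF hcarr H] by (auto dest: subgroup.subset)
  have "virtually_contained G (conj_set G h H) (conj_set G g H)"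
    using virtually_contained_conj_set[OF HHg sub(1) hcarr] conj_set_eq_self[OF Hg h] by simp
  moreover have "virtually_contained G (conj_set G g H) (conj_set G h H)"
    using virtually_contained_conj_set[OF HgH sub(2) hcarr] conj_set_eq_self[OF Hg h] by simp
  ultimately show "h \<in> commensurator G H"
    unfolding commensurator_iff[OF H] using hcarr HHg HgH sub virtually_contained_trans by blast
qed

section \<open>Elements moved trivially modulo a normal subgroup\<close>

lemma normal_in_subgroupD:
  assumes H: "subgroup H G" and K: "K \<lhd> G\<lparr>carrier := H\<rparr>"
  shows "subgroup K G" and "K \<subseteq> H"
    and "\<And>x k. x \<in> H \<Longrightarrow> k \<in> K \<Longrightarrow> conj_elt G x k \<in> K"
    and "\<And>x k. x \<in> H \<Longrightarrow> k \<in> K \<Longrightarrow> x \<otimes> k \<otimes> inv x \<in> K"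
proof -
  have sub: "subgroup K (G\<lparr>carrier := H\<rparr>)" using K by (rule normal_imp_subgroup)
  show "subgroup K G" using sub H by (simp add: incl_subgroup)
  show "K \<subseteq> H" using subgroup.subset[OF sub] by simp
  show "conj_elt G x k \<in> K" if "x \<in> H" "k \<in> K" for x k
    using normal.inv_op_closed1[OF K, of x k] that m_inv_consistent[OF H]
    by (simp add: conj_elt_def)
  show "x \<otimes> k \<otimes> inv x \<in> K" if "x \<in> H" "k \<in> K" for x k
    using normal.inv_op_closed2[OF K, of x k] that m_inv_consistent[OF H] by simp
qed

lemma subgroup_fixed_modulo:
  assumes H: "subgroup H G" and K: "K \<lhd> G\<lparr>carrier := H\<rparr>" and h: "h \<in> carrier G"
  shows "subgroup (fixed_modulo G H K h) G"
proof -
  note KD = normal_in_subgroupD[OF H K]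
  have Hcarr: "x \<in> carrier G" if "x \<in> H" for x using H that by (rule subgroup.mem_carrier)
  show ?thesis
  proof (rule subgroupI)
    show "fixed_modulo G H K h \<subseteq> carrier G" using Hcarr by (auto simp: fixed_modulo_def)
    have "\<one> \<in> fixed_modulo G H K h"
      using H KD(1) h by (simp add: fixed_modulo_def conj_elt_def subgroup.one_closed)
    then show "fixed_modulo G H K h \<noteq> {}" by blast
  next
    fix d assume "d \<in> fixed_modulo G H K h"
    then have d: "d \<in> H" "conj_elt G h d \<otimes> inv d \<in> K" by (auto simp: fixed_modulo_def)
    \<comment> \<open>The commutator for \<open>d\<^sup>-\<^sup>1\<close> is the inverse of the one for \<open>d\<close>, conjugated by \<open>d\<close>.\<close>
    have "conj_elt G d (inv (conj_elt G h d \<otimes> inv d)) \<in> K"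
      using KD(3)[OF d(1) subgroup.m_inv_closed[OF KD(1) d(2)]] .
    moreover have "conj_elt G d (inv (conj_elt G h d \<otimes> inv d))
        = conj_elt G h (inv d) \<otimes> inv (inv d)"
      using d h Hcarr by (simp add: conj_elt_def group_word_simps)
    ultimately show "inv d \<in> fixed_modulo G H K h"
      using d H by (simp add: fixed_modulo_def subgroup.m_inv_closed)
  next
    fix d e assume "d \<in> fixed_modulo G H K h" "e \<in> fixed_modulo G H K h"
    then have d: "d \<in> H" "conj_elt G h d \<otimes> inv d \<in> K"
      and e: "e \<in> H" "conj_elt G h e \<otimes> inv e \<in> K" by (auto simp: fixed_modulo_def)
    have "(conj_elt G h d \<otimes> inv d) \<otimes> (d \<otimes> (conj_elt G h e \<otimes> inv e) \<otimes> inv d) \<in> K"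
      using KD(4)[OF d(1) e(2)] d(2) subgroup.m_closed[OF KD(1)] by blast
    moreover have "(conj_elt G h d \<otimes> inv d) \<otimes> (d \<otimes> (conj_elt G h e \<otimes> inv e) \<otimes> inv d)
        = conj_elt G h (d \<otimes> e) \<otimes> inv (d \<otimes> e)"
      using d e h Hcarr by (simp add: conj_elt_def group_word_simps)
    ultimately show "d \<otimes> e \<in> fixed_modulo G H K h"
      using d e H by (simp add: fixed_modulo_def subgroup.m_closed)
  qed
qed

text \<open>Elements of \<open>H \<inter> H\<^sup>g\<close> act by conjugation on the finitely many right cosets of \<open>K \<inter> K\<^sup>g\<close> in
  \<open>K\<^sup>g\<close>. The commutator \<open>d\<^sup>-\<^sup>1 h\<^sup>-\<^sup>1 d h \<in> K\<^sup>g\<close> measures how \<open>d\<close> moves the coset of \<open>h\<^sup>-\<^sup>1\<close>; if it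
  takes values in one coset of \<open>K\<close> at \<open>i\<close> and \<open>j\<close>, then \<open>i j\<^sup>-\<^sup>1\<close> fixes the coset of \<open>h\<^sup>-\<^sup>1\<close>.\<close>

lemma virtually_contained_fixed_modulo:
  assumes H: "subgroup H G" and K: "K \<lhd> G\<lparr>carrier := H\<rparr>" and g: "g \<in> carrier G"
    and KgK: "virtually_contained G (conj_set G g K) K" and h: "h \<in> conj_set G g K"
  shows "virtually_contained G (H \<inter> conj_set G g H) (fixed_modulo G H K h)"
proof -
  note KD = normal_in_subgroupD[OF H K]
  have Hcarr: "x \<in> carrier G" if "x \<in> H" for x using H that by (rule subgroup.mem_carrier)
  have Kg: "subgroup (conj_set G g K) G" using g KD(1) by (rule subgroup_conj_set)
  have hcarr: "h \<in> carrier G" using Kg h by (rule subgroup.mem_carrier)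
  obtain k where k: "k \<in> K" "h = conj_elt G g k" using h unfolding conj_set_def by blast
  let ?\<psi> = "\<lambda>d. conj_elt G d (inv h) \<otimes> h"
  show ?thesis
  proof (rule virtually_contained_vimage[OF KgK KD(1) subgroup.subset[OF Kg], of _ ?\<psi>])
    show "H \<inter> conj_set G g H \<subseteq> carrier G" using Hcarr by auto
    show "?\<psi> ` (H \<inter> conj_set G g H) \<subseteq> conj_set G g K"
    proof
      fix x assume "x \<in> ?\<psi> ` (H \<inter> conj_set G g H)"
      then obtain d where d: "d \<in> H" "x = ?\<psi> (conj_elt G g d)" unfolding conj_set_def by blast
      have "conj_elt G d (inv k) \<otimes> k \<in> K"
        using KD(1) KD(3)[OF d(1)] k by (simp add: subgroup.m_closed subgroup.m_inv_closed)
      moreover have "x = conj_elt G g (conj_elt G d (inv k) \<otimes> k)"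
        using d k g Hcarr KD(2) by (simp add: conj_elt_def group_word_simps subset_iff)
      ultimately show "x \<in> conj_set G g K" unfolding conj_set_def by blast
    qed
  next
    fix i j assume i: "i \<in> H \<inter> conj_set G g H" and j: "j \<in> H \<inter> conj_set G g H"
      and ij: "?\<psi> i \<otimes> inv (?\<psi> j) \<in> K"
    \<comment> \<open>The factors \<open>h\<close> cancel, leaving the commutator for \<open>i j\<^sup>-\<^sup>1\<close> conjugated by \<open>i\<close>, which
      normalizes \<open>K\<close>.\<close>
    have "i \<otimes> (?\<psi> i \<otimes> inv (?\<psi> j)) \<otimes> inv i \<in> K" using KD(4) i ij by blast
    moreover have "i \<otimes> (?\<psi> i \<otimes> inv (?\<psi> j)) \<otimes> inv i
        = conj_elt G h (i \<otimes> inv j) \<otimes> inv (i \<otimes> inv j)"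
      using i j hcarr Hcarr by (simp add: conj_elt_def group_word_simps)
    ultimately show "i \<otimes> inv j \<in> fixed_modulo G H K h"
      using i j H by (simp add: fixed_modulo_def subgroup.m_closed subgroup.m_inv_closed)
  qed
qed

section \<open>Preservation of lines with holes\<close>

lemma preserves_lines_with_holes_if_virtually_contained:
  assumes H: "subgroup H G" and K: "K \<lhd> G\<lparr>carrier := H\<rparr>" and h: "h \<in> commensurator G H"
    and S: "virtually_contained G H (fixed_modulo G H K h)"
  shows "preserves_lines_with_holes G H K h"
proof -
  note KD = normal_in_subgroupD[OF H K]
  have hcarr: "h \<in> carrier G" using h by (simp add: commensurator_def)
  have "\<exists>N::int. N > 0 \<and> (\<forall>n. N dvd n \<longrightarrow> conj_elt G h (\<gamma> [^] n) \<in> H \<and>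
      conj_elt G h (\<gamma> [^] n) \<otimes> \<gamma> [^] (- n) \<in> K)" if \<gamma>: "\<gamma> \<in> H" for \<gamma>
  proof -
    have \<gamma>carr: "\<gamma> \<in> carrier G" using H \<gamma> by (rule subgroup.mem_carrier)
    obtain N :: int where N: "N > 0" "\<And>n. N dvd n \<Longrightarrow> \<gamma> [^] n \<in> fixed_modulo G H K h"
      using int_pow_mem_if_virtually_contained[OF S H subgroup_fixed_modulo[OF H K hcarr] \<gamma>]
      by blast
    have "conj_elt G h (\<gamma> [^] n) \<in> H \<and> conj_elt G h (\<gamma> [^] n) \<otimes> \<gamma> [^] (- n) \<in> K"
      if "N dvd n" for n
    proof -
      have pow: "\<gamma> [^] n \<in> H" and comm: "conj_elt G h (\<gamma> [^] n) \<otimes> inv (\<gamma> [^] n) \<in> K"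
        using N(2)[OF that] by (auto simp: fixed_modulo_def)
      \<comment> \<open>An element congruent to \<open>\<gamma>\<^sup>n\<close> modulo \<open>K\<close> lies in \<open>K H = H\<close>.\<close>
      have "(conj_elt G h (\<gamma> [^] n) \<otimes> inv (\<gamma> [^] n)) \<otimes> \<gamma> [^] n \<in> H"
        using comm pow KD(2) H by (auto intro: subgroup.m_closed)
      then have "conj_elt G h (\<gamma> [^] n) \<in> H" using \<gamma>carr hcarr by (simp add: m_assoc)
      then show ?thesis using comm \<gamma>carr by (simp add: int_pow_neg)
    qed
    then show ?thesis using N(1) by blast
  qed
  then show ?thesis using h unfolding preserves_lines_with_holes_def by blast
qed

end

theorem theorem1p4:
  fixes G :: "('a, 'b) monoid_scheme" and \<Gamma> K :: "'a set" and g :: 'a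
  assumes "group G"
    and "subgroup \<Gamma> G"
    and "K \<lhd> G\<lparr>carrier := \<Gamma>\<rparr>"
    and "g \<in> commensurator G K \<inter> commensurator G \<Gamma>"
  shows "\<forall>h \<in> conj_set G g K. preserves_lines_with_holes G \<Gamma> K h"
proof
  interpret group G by fact
  note \<Gamma> = assms(2) and K = assms(3)
  note KD = normal_in_subgroupD[OF \<Gamma> K]
  fix h assume h: "h \<in> conj_set G g K"
  have g: "g \<in> carrier G" and KgK: "virtually_contained G (conj_set G g K) K"
    using assms(4) commensurator_iff[OF KD(1)] by auto
  have comm: "h \<in> commensurator G \<Gamma>"
    using conj_set_subset_commensurator[OF \<Gamma>] assms(4) h KD(2) unfolding conj_set_def by blast
  have "finite_index G (\<Gamma> \<inter> conj_set G g \<Gamma>) \<Gamma>"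
    using assms(4) by (simp add: commensurator_def)
  then have "virtually_contained G \<Gamma> (\<Gamma> \<inter> conj_set G g \<Gamma>)"
    using \<Gamma> by (rule virtually_contained_if_finite_index)
  then have "virtually_contained G \<Gamma> (fixed_modulo G \<Gamma> K h)"
    using virtually_contained_fixed_modulo[OF \<Gamma> K g KgK h] subgroup.subset[OF \<Gamma>]
    by (rule virtually_contained_trans)
  with \<Gamma> K comm show "preserves_lines_with_holes G \<Gamma> K h"
    by (rule preserves_lines_with_holes_if_virtually_contained)
qed

end
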